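(* Let $\ell,n\ge 0$ be integers such that $\mathcal E(\ell,n)\neq\emptyset$. Then $\ell\le n-n_{\min}+\ell_{\min}$.
   Context: Fix integers $m,p\ge 1$ and $T\ge 1$; $[i,j]$ denotes the integers from $i$ to $j$. Matrices with zero rows or columns are allowed (the product of an $a\times 0$ and a $0\times b$ matrix is the zero $a\times b$ matrix; void matrices have rank $0$). Systems. For $n\ge 0$, a system with $n$ states is a matrix $\begin{bmatrix}A&B\\C&D\end{bmatrix}\in\mathbb R^{(n+p)\times(n+m)}$ with $A\in\mathbb R^{n\times n}$, $B\in\mathbb R^{n\times m}$, $C\in\mathbb R^{p\times n}$, $D\in\mathbb R^{p\times m}$, representing $x(t+1)=Ax(t)+Bu(t)$, $y(t)=Cx(t)+Du(t)$. Let $\Omega_{-1}$ be the $0\times n$ matrix and, for $k\ge 0$, let $\Omega_k$ be the matrix obtained by stacking $C,CA,\dots,CA^k$. The lag $\ell(C,A)$ is the smallest integer $k\ge 0$ with $\operatorname{rank}\Omega_k=\operatorname{rank}\Omega_{k-1}$. $\mathcal S(\ell,n)$ is the set of systems with $n$ states and lag $\ell$; $\mathcal S(n)=\bigcup_{\ell\in[0,n]}\mathcal S(\ell,n)$. A system is minimal if $(C,A)$ is observable and $(A,B)$ is controllable (for $n=0$ both hold by convention). Data. $u_{[0,T-1]}=[u_0\ \cdots\ u_{T-1}]\in\mathbb R^{m\times T}$ and $y_{[0,T-1]}=[y_0\ \cdots\ y_{T-1}]\in\mathbb R^{p\times T}$, with $u_{[0,T-1]}\ne 0$. A system in $\mathcal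 S(n)$ explains the data if there is $x_{[0,T]}=[x_0\ \cdots\ x_T]\in\mathbb R^{n\times(T+1)}$ with $x_{t+1}=Ax_t+Bu_t$ and $y_t=Cx_t+Du_t$ for all $t\in[0,T-1]$. $\mathcal E(n)$ is the set of systems in $\mathcal S(n)$ explaining the data and $\mathcal E(\ell,n)$ the set of those in $\mathcal S(\ell,n)$. The data are generated by (i.e. explained by) some minimal "true" system. Minimal invariants. $\ell_{\min}:=\min\{\ell\ge 0:\mathcal E(\ell,n)\ne\emptyset\text{ for some }n\ge 0\}$ and $n_{\min}:=\min\{n\ge 0:\mathcal E(n)\ne\emptyset\}$. *)

theory Defs
  imports "HOL.Real" "Jordan_Normal_Form.DL_Rank"
begin

definition mat_rank :: "real mat \<Rightarrow> nat" where
  "mat_rank M = vec_space.rank (dim_row M) M"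

(* obs_mat C A k stacks the k blocks C, C A, ..., C A^(k-1), so it is Omega_(k-1);
   the index is shifted by one so that Omega_(-1), with no rows, is obs_mat C A 0. *)
primrec obs_mat :: "real mat \<Rightarrow> real mat \<Rightarrow> nat \<Rightarrow> real mat" where
  "obs_mat C A 0 = 0\<^sub>m 0 (dim_col A)"
| "obs_mat C A (Suc k) = obs_mat C A k @\<^sub>r (C * (A ^\<^sub>m k))"

(* ctrb_mat A B k = [B, A B, ..., A^(k-1) B] *)
primrec ctrb_mat :: "real mat \<Rightarrow> real mat \<Rightarrow> nat \<Rightarrow> real mat" where
  "ctrb_mat A B 0 = 0\<^sub>m (dim_row A) 0"
| "ctrb_mat A B (Suc k) =
    four_block_mat (ctrb_mat A B k) ((A ^\<^sub>m k) * B)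
      (0\<^sub>m 0 (dim_col (ctrb_mat A B k))) (0\<^sub>m 0 (dim_col B))"

(* rank Omega_k = rank Omega_(k-1) at the minimum, in the shifted indexing of obs_mat *)
definition lag :: "real mat \<Rightarrow> real mat \<Rightarrow> nat" where
  "lag C A = (LEAST k. mat_rank (obs_mat C A (Suc k)) = mat_rank (obs_mat C A k))"

definition observable :: "real mat \<Rightarrow> real mat \<Rightarrow> bool" where
  "observable C A \<longleftrightarrow> mat_rank (obs_mat C A (dim_row A)) = dim_row A"

definition controllable :: "real mat \<Rightarrow> real mat \<Rightarrow> bool" where
  "controllable A B \<longleftrightarrow> mat_rank (ctrb_mat A B (dim_row A)) = dim_row A"

(* the block matrix [A B; C D], kept as the tuple (A, B, C, D) of its blocks *)
type_synonym lin_system = "real mat \<times> real mat \<times> real mat \<times> real mat"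

fun minimal_system :: "lin_system \<Rightarrow> bool" where
  "minimal_system (A, B, C, D) \<longleftrightarrow> observable C A \<and> controllable A B"

definition systems_lag :: "nat \<Rightarrow> nat \<Rightarrow> nat \<Rightarrow> nat \<Rightarrow> lin_system set" where
  "systems_lag m p l n = {(A, B, C, D).
     A \<in> carrier_mat n n \<and> B \<in> carrier_mat n m \<and> C \<in> carrier_mat p n \<and> D \<in> carrier_mat p m \<and>
     lag C A = l}"

definition systems :: "nat \<Rightarrow> nat \<Rightarrow> nat \<Rightarrow> lin_system set" where
  "systems m p n = (\<Union>l\<in>{0..n}. systems_lag m p l n)"

(* The columns of u and y are the samples; T is the number of columns of u, and the number of
   states is the size of A. *)
fun explains :: "real mat \<Rightarrow> real mat \<Rightarrow> lin_system \<Rightarrow> bool" where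
  "explains u y (A, B, C, D) \<longleftrightarrow>
     (\<exists>x \<in> carrier_mat (dim_row A) (dim_col u + 1). \<forall>t < dim_col u.
        col x (t + 1) = A *\<^sub>v col x t + B *\<^sub>v col u t \<and>
        col y t = C *\<^sub>v col x t + D *\<^sub>v col u t)"

(* The input and output dimensions m and p are the numbers of rows of u and y. *)
definition expl_systems :: "real mat \<Rightarrow> real mat \<Rightarrow> nat \<Rightarrow> lin_system set" where
  "expl_systems u y n = {S \<in> systems (dim_row u) (dim_row y) n. explains u y S}"

definition expl_systems_lag :: "real mat \<Rightarrow> real mat \<Rightarrow> nat \<Rightarrow> nat \<Rightarrow> lin_system set" where
  "expl_systems_lag u y l n = {S \<in> systems_lag (dim_row u) (dim_row y) l n. explains u y S}"

definition l_min :: "real mat \<Rightarrow> real mat \<Rightarrow> nat" where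
  "l_min u y = (LEAST l. \<exists>n. expl_systems_lag u y l n \<noteq> {})"

definition n_min :: "real mat \<Rightarrow> real mat \<Rightarrow> nat" where
  "n_min u y = (LEAST n. expl_systems u y n \<noteq> {})"

end

theory Submission
  imports Defs
begin

text \<open>Take an explaining system with lag \<open>l\<close> and \<open>n\<close> states and one with the minimal lag \<open>l'\<close>. List the
  rows of \<open>C\<close>, \<open>CA\<close>, \<open>CA\<^sup>2\<close>, \<dots> of the first one in order and call a row new if it is not in the span of
  the previous ones. There are at most \<open>n\<close> new rows, and each block \<open>CA\<^sup>s\<close> with \<open>s < l\<close> contains one, so at
  most \<open>n - (l - l')\<close> of them lie in the blocks \<open>s < l'\<close>. For each output \<open>i\<close>, let \<open>\<mu>\<^sub>i\<close> be the first \<open>s\<close> such that row \<open>i\<close> of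
  \<open>CA\<^sup>s\<close> is not new, capped at \<open>l'\<close>. Then \<open>y\<^sub>i(t + \<mu>\<^sub>i)\<close> is a linear combination of inputs and of
  preceding outputs, along the whole data: by the first system if \<open>\<mu>\<^sub>i < l'\<close>, by the second one if
  \<open>\<mu>\<^sub>i = l'\<close>. These mixed difference equations still have a unit lower triangular leading
  coefficient matrix, so they are realized by a system with \<open>\<Sum>\<^sub>i \<mu>\<^sub>i \<le> n - (l - l')\<close> states.\<close>

section \<open>Rank and kernel\<close>

text \<open>Independence of the family indexed by \<open>I\<close>, not of a set of columns, so
  equal columns count as dependent. The row index of \<open>v\<close> is unbounded, so one
  \<open>v\<close> serves every number \<open>Q\<close> of rows.\<close>

definition col_indep :: "(nat \<Rightarrow> nat \<Rightarrow> real) \<Rightarrow> nat \<Rightarrow> nat set \<Rightarrow> bool" where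
  "col_indep v Q I \<longleftrightarrow> (\<forall>a. (\<forall>q<Q. (\<Sum>j\<in>I. a j * v q j) = 0) \<longrightarrow> (\<forall>j\<in>I. a j = 0))"

lemma col_indepD:
  assumes "col_indep v Q I" "\<And>q. q < Q \<Longrightarrow> (\<Sum>j\<in>I. a j * v q j) = 0" "j \<in> I"
  shows "a j = 0"
  using assms unfolding col_indep_def by blast

lemma col_indep_cong:
  assumes "\<And>q j. q < Q \<Longrightarrow> j \<in> I \<Longrightarrow> v q j = w q j" "col_indep v Q I"
  shows "col_indep w Q I"
  unfolding col_indep_def
proof (intro allI impI ballI)
  fix a j assume a: "\<forall>q<Q. (\<Sum>j\<in>I. a j * w q j) = 0" and j: "j \<in> I"
  show "a j = 0"
  proof (rule col_indepD[OF assms(2) _ j])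
    fix q assume q: "q < Q"
    have "(\<Sum>j\<in>I. a j * v q j) = (\<Sum>j\<in>I. a j * w q j)"
      using assms(1)[OF q] by (intro sum.cong) auto
    thus "(\<Sum>j\<in>I. a j * v q j) = 0" using a q by simp
  qed
qed

text \<open>The library rank counts independent sets of column vectors. Independence of the family
  makes \<open>col M\<close> injective on \<open>I\<close>, so no cardinality is lost.\<close>

lemma card_le_rank:
  assumes M: "M \<in> carrier_mat nr nc" and I: "I \<subseteq> {..<nc}"
    and ind: "col_indep (\<lambda>i j. M $$ (i,j)) nr I"
  shows "card I \<le> vec_space.rank nr (M :: real mat)"
proof -
  interpret vec_space "TYPE(real)" nr .
  have finI: "finite I" using I finite_subset by blast
  have colI: "col M j $ i = M $$ (i,j)" if "j \<in> I" "i < nr" for i j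
    using that I M by auto
  have inj: "inj_on (col M) I"
  proof (rule inj_onI, rule ccontr)
    fix j k assume jk: "j \<in> I" "k \<in> I" "col M j = col M k" "j \<noteq> k"
    \<comment> \<open>Equal columns would satisfy the relation with coefficient 1 at
      \<open>j\<close> and -1 at \<open>k\<close>.\<close>
    let ?a = "\<lambda>l. (if l = j then 1 else 0) - (if l = k then 1 else 0 :: real)"
    have "(\<Sum>l\<in>I. ?a l * M $$ (i,l)) = 0" if that: "i < nr" for i
    proof -
      have "(\<Sum>l\<in>I. ?a l * M $$ (i,l)) = (\<Sum>l\<in>I. (if l = j then M $$ (i,l) else 0)) - (\<Sum>l\<in>I. (if l = k then M $$ (i,l) else 0))"
        by (subst sum_subtractf[symmetric], rule sum.cong) auto
      also have "\<dots> = M $$ (i,j) - M $$ (i,k)" using jk finI by (simp add: sum.delta)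
      also have "\<dots> = 0" using colI[OF jk(1) that] colI[OF jk(2) that] jk(3) by simp
      finally show ?thesis .
    qed
    from col_indepD[OF ind this jk(1)] jk(4) show False by simp
  qed
  let ?S = "col M ` I"
  have Scar: "?S \<subseteq> carrier_vec nr" using M by auto
  have "lin_indpt ?S"
  proof
    assume "lin_dep ?S"
    then obtain a w where a: "lincomb a ?S = 0\<^sub>v nr" "w \<in> ?S" "a w \<noteq> 0"
      using finite_lin_dep[of ?S] finI Scar by auto
    have "(\<Sum>j\<in>I. a (col M j) * M $$ (i,j)) = 0" if i: "i < nr" for i
    proof -
      have "0 = lincomb a ?S $ i" using a i by simp
      also have "\<dots> = (\<Sum>x\<in>?S. a x * x $ i)" by (rule lincomb_index[OF i Scar])
      also have "\<dots> = (\<Sum>j\<in>I. a (col M j) * col M j $ i)" by (subst sum.reindex[OF inj]) simp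
      also have "\<dots> = (\<Sum>j\<in>I. a (col M j) * M $$ (i,j))" using colI i by (intro sum.cong) auto
      finally show ?thesis by simp
    qed
    from col_indepD[OF ind this] a show False by auto
  qed
  moreover have "?S \<subseteq> set (cols M)" using I M by (force simp: cols_def)
  ultimately have "rank M \<ge> card ?S" using rank_ge_card_indpt[OF M] by blast
  thus ?thesis using card_image[OF inj] by simp
qed

text \<open>A maximal independent set of columns has as many members as the rank; one index is
  chosen for each member.\<close>

lemma rank_attained:
  assumes M: "(M :: real mat) \<in> carrier_mat nr nc"
  obtains I where "I \<subseteq> {..<nc}" "col_indep (\<lambda>i j. M $$ (i,j)) nr I" "card I = vec_space.rank nr M"
proof -
  interpret vec_space "TYPE(real)" nr .
  have "lin_indpt {}" by (rule ccontr) (auto simp: lin_dep_def)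
  then obtain S where S: "maximal S (\<lambda>T. T \<subseteq> set (cols M) \<and> lin_indpt T)"
    using maximal_exists_superset[of "set (cols M)" "(\<lambda>T. T \<subseteq> set (cols M) \<and> lin_indpt T)" "{}"] by auto
  have rk: "rank M = card S" by (rule rank_card_indpt[OF M S])
  from S have SM: "S \<subseteq> set (cols M)" and li: "lin_indpt S" by (auto simp: maximal_def)
  have "set (cols M) = col M ` {..<nc}" using M by (auto simp: cols_def)
  with SM obtain I where I: "I \<subseteq> {..<nc}" "inj_on (col M) I" "S = col M ` I"
    by (metis subset_image_inj)
  have finI: "finite I" using I finite_subset by blast
  have Scar: "S \<subseteq> carrier_vec nr" using M I by auto
  have colI: "col M j $ i = M $$ (i,j)" if "j \<in> I" "i < nr" for i j
    using that I M by auto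
  have "col_indep (\<lambda>i j. M $$ (i,j)) nr I"
    unfolding col_indep_def
  proof (intro allI impI ballI, rule ccontr)
    fix a j assume a: "\<forall>q<nr. (\<Sum>j\<in>I. a j * M $$ (q,j)) = 0" and j: "j \<in> I" "a j \<noteq> 0"
    let ?b = "\<lambda>x. a (inv_into I (col M) x)"
    have b: "?b (col M l) = a l" if "l \<in> I" for l using that I by simp
    have "lincomb ?b S = 0\<^sub>v nr"
    proof (rule eq_vecI)
      fix i assume "i < dim_vec (0\<^sub>v nr :: real vec)"
      hence i: "i < nr" by simp
      have "lincomb ?b S $ i = (\<Sum>x\<in>S. ?b x * x $ i)" by (rule lincomb_index[OF i Scar])
      also have "\<dots> = (\<Sum>l\<in>I. ?b (col M l) * col M l $ i)" unfolding I(3) by (subst sum.reindex[OF I(2)]) simp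
      also have "\<dots> = (\<Sum>l\<in>I. a l * M $$ (i,l))" using colI i b by (intro sum.cong) auto
      also have "\<dots> = 0" using a i by simp
      finally show "lincomb ?b S $ i = 0\<^sub>v nr $ i" using i by simp
    qed (use Scar lincomb_dim[of S] finI I in auto)
    moreover have "finite S" "col M j \<in> S" "?b (col M j) \<noteq> 0" using finI I j b by auto
    ultimately have "lin_dep S" using lin_dep_crit[of S S "col M j" ?b] Scar by auto
    with li show False by simp
  qed
  with I(1) rk card_image[OF I(2)] I(3) that show ?thesis by auto
qed

section \<open>Kernels of the leading rows, and rows outside the span of the preceding ones\<close>

definition row_kernel :: "(nat \<Rightarrow> nat \<Rightarrow> real) \<Rightarrow> nat \<Rightarrow> nat \<Rightarrow> (nat \<Rightarrow> real) set" where
  "row_kernel v n Q = {x. \<forall>q<Q. (\<Sum>b<n. v q b * x b) = 0}"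

lemma row_kernel_mono: "Q \<le> Q' \<Longrightarrow> row_kernel v n Q' \<subseteq> row_kernel v n Q"
  by (auto simp: row_kernel_def)

lemma col_indep_mono: "Q \<le> Q' \<Longrightarrow> col_indep v Q I \<Longrightarrow> col_indep v Q' I"
  unfolding col_indep_def by (meson order_less_le_trans)

text \<open>Relations among the columns in \<open>I\<close> are kernel vectors supported in
  \<open>I\<close>. Hence independence of columns depends on the rows only through their
  kernel.\<close>

lemma col_indep_iff_row_kernel:
  assumes "I \<subseteq> {..<n}"
  shows "col_indep v Q I \<longleftrightarrow> (\<forall>x\<in>row_kernel v n Q. (\<forall>b. b \<notin> I \<longrightarrow> x b = 0) \<longrightarrow> (\<forall>b\<in>I. x b = 0))"
proof -
  have fin: "finite I" using assms finite_subset by blast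
  have eq: "(\<Sum>b<n. v q b * (if b \<in> I then a b else 0)) = (\<Sum>j\<in>I. a j * v q j)" for a q
    using assms by (intro sum.mono_neutral_cong_right) auto
  show ?thesis
  proof
    assume L: "col_indep v Q I"
    show "\<forall>x\<in>row_kernel v n Q. (\<forall>b. b \<notin> I \<longrightarrow> x b = 0) \<longrightarrow> (\<forall>b\<in>I. x b = 0)"
    proof (intro ballI impI)
      fix x b assume x: "x \<in> row_kernel v n Q" "\<forall>b. b \<notin> I \<longrightarrow> x b = 0" "b \<in> I"
      have xI: "x c = (if c \<in> I then x c else 0)" for c using x by auto
      have "(\<Sum>j\<in>I. x j * v q j) = 0" if "q < Q" for q
        unfolding eq[symmetric] xI[symmetric] using x(1) that by (simp add: row_kernel_def)
      from col_indepD[OF L this x(3)] show "x b = 0" .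
    qed
  next
    assume R: "\<forall>x\<in>row_kernel v n Q. (\<forall>b. b \<notin> I \<longrightarrow> x b = 0) \<longrightarrow> (\<forall>b\<in>I. x b = 0)"
    show "col_indep v Q I" unfolding col_indep_def
    proof (intro allI impI ballI)
      fix a j assume a: "\<forall>q<Q. (\<Sum>j\<in>I. a j * v q j) = 0" "j \<in> I"
      let ?x = "\<lambda>b. if b \<in> I then a b else 0"
      have "?x \<in> row_kernel v n Q" using a eq[of _ a] unfolding row_kernel_def by auto
      from R[rule_format, OF this, of j] a show "a j = 0" by simp
    qed
  qed
qed

lemma mat_rank_mat_attained:
  obtains I where "I \<subseteq> {..<n}" "col_indep v Q I" "card I = mat_rank (mat Q n (\<lambda>(q,b). v q b))"
proof -
  let ?M = "mat Q n (\<lambda>(q,b). v q b)"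
  obtain I where I: "I \<subseteq> {..<n}" "col_indep (\<lambda>i j. ?M $$ (i,j)) Q I" "card I = vec_space.rank Q ?M"
    by (rule rank_attained[of ?M Q n]) auto
  have "col_indep v Q I" by (rule col_indep_cong[OF _ I(2)]) (use I(1) in auto)
  with I that show ?thesis by (simp add: mat_rank_def)
qed

lemma card_le_mat_rank_mat:
  assumes "I \<subseteq> {..<n}" "col_indep v Q I"
  shows "card I \<le> mat_rank (mat Q n (\<lambda>(q,b). v q b))"
proof -
  let ?M = "mat Q n (\<lambda>(q,b). v q b)"
  have "col_indep (\<lambda>i j. ?M $$ (i,j)) Q I"
    by (rule col_indep_cong[OF _ assms(2)]) (use assms(1) in auto)
  from card_le_rank[OF _ assms(1) this] show ?thesis by (simp add: mat_rank_def)
qed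

lemma mat_rank_mat_mono:
  assumes "Q \<le> Q'"
  shows "mat_rank (mat Q n (\<lambda>(q,b). v q b)) \<le> mat_rank (mat Q' n (\<lambda>(q,b). v q b))"
  using mat_rank_mat_attained[of n v Q] card_le_mat_rank_mat[of _ n v Q'] col_indep_mono[OF assms]
  by metis

lemma mat_rank_mat_le: "mat_rank (mat Q n (\<lambda>(q,b). v q b)) \<le> n"
  using mat_rank_mat_attained[of n v Q] by (metis card_lessThan card_mono finite_lessThan)

text \<open>Equal kernels give the same independent column sets. Conversely, if the ranks agree, a
  column basis over \<open>Q\<close> rows stays one over \<open>Q'\<close> rows, and any relation
  between all columns reduces to one on the basis, which \<open>Q\<close> rows already force to be
  trivial.\<close>

lemma mat_rank_eq_iff_row_kernel:
  assumes QQ: "Q \<le> Q'"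
  shows "mat_rank (mat Q n (\<lambda>(q,b). v q b)) = mat_rank (mat Q' n (\<lambda>(q,b). v q b)) \<longleftrightarrow>
    row_kernel v n Q = row_kernel v n Q'"
proof
  assume K: "row_kernel v n Q = row_kernel v n Q'"
  have "I \<subseteq> {..<n} \<Longrightarrow> col_indep v Q I = col_indep v Q' I" for I
    using K by (simp add: col_indep_iff_row_kernel)
  thus "mat_rank (mat Q n (\<lambda>(q,b). v q b)) = mat_rank (mat Q' n (\<lambda>(q,b). v q b))"
    by (metis mat_rank_mat_attained[of n v] card_le_mat_rank_mat[of _ n v] order_antisym)
next
  assume R: "mat_rank (mat Q n (\<lambda>(q,b). v q b)) = mat_rank (mat Q' n (\<lambda>(q,b). v q b))"
  obtain I where I: "I \<subseteq> {..<n}" "col_indep v Q I" "card I = mat_rank (mat Q n (\<lambda>(q,b). v q b))"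
    by (rule mat_rank_mat_attained)
  have finI: "finite I" using I finite_subset by blast
  have I': "col_indep v Q' I" using I(2) QQ col_indep_mono by blast
  have "\<exists>c. \<forall>q<Q'. v q j = (\<Sum>i\<in>I. c i * v q i)" if j: "j < n" for j
  proof (cases "j \<in> I")
    case True
    have "\<forall>q<Q'. v q j = (\<Sum>i\<in>I. (if i = j then 1 else 0) * v q i)"
      using True finI by (simp add: if_distrib[of "\<lambda>x. x * _"] sum.delta cong: if_cong)
    thus ?thesis by (rule exI[of _ "\<lambda>i. if i = j then 1 else 0"])
  next
    case False
    \<comment> \<open>By equality of ranks \<open>I\<close> already has maximal size over
      \<open>Q'\<close> rows.\<close>
    have "\<not> col_indep v Q' (insert j I)"
      using card_le_mat_rank_mat[of "insert j I" n v Q'] I j R False finI by auto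
    then obtain a k where a: "\<forall>q<Q'. (\<Sum>i\<in>insert j I. a i * v q i) = 0" "k \<in> insert j I" "a k \<noteq> 0"
      unfolding col_indep_def by blast
    have a': "a j * v q j + (\<Sum>i\<in>I. a i * v q i) = 0" if "q < Q'" for q
      using a(1) that False finI by simp
    have aj: "a j \<noteq> 0"
    proof
      assume "a j = 0"
      hence "\<forall>q<Q'. (\<Sum>i\<in>I. a i * v q i) = 0" using a' by simp
      with col_indepD[OF I'] a \<open>a j = 0\<close> show False by blast
    qed
    have "v q j = (\<Sum>i\<in>I. (- a i / a j) * v q i)" if "q < Q'" for q
    proof -
      have "v q j = - (\<Sum>i\<in>I. a i * v q i) / a j" using a'[OF that] aj by (simp add: field_simps)
      also have "\<dots> = (\<Sum>i\<in>I. (- a i / a j) * v q i)" by (simp add: sum_divide_distrib sum_negf)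
      finally show ?thesis .
    qed
    thus ?thesis by (intro exI[of _ "\<lambda>i. - a i / a j"]) blast
  qed
  then obtain c where c: "\<And>j q. j < n \<Longrightarrow> q < Q' \<Longrightarrow> v q j = (\<Sum>i\<in>I. c j i * v q i)"
    by metis
  have "x \<in> row_kernel v n Q'" if x: "x \<in> row_kernel v n Q" for x
  proof -
    \<comment> \<open>Coordinates, with respect to the columns in \<open>I\<close>, of the
      combination of all columns with weights \<open>x\<close>.\<close>
    define d where "d i = (\<Sum>j<n. x j * c j i)" for i
    have d: "(\<Sum>b<n. v q b * x b) = (\<Sum>i\<in>I. d i * v q i)" if "q < Q'" for q
    proof -
      have "(\<Sum>b<n. v q b * x b) = (\<Sum>b<n. \<Sum>i\<in>I. x b * c b i * v q i)"
        using c that by (intro sum.cong) (auto simp: sum_distrib_left mult_ac)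
      also have "\<dots> = (\<Sum>i\<in>I. d i * v q i)"
        unfolding d_def sum_distrib_right by (rule sum.swap)
      finally show ?thesis .
    qed
    have "\<forall>q<Q. (\<Sum>i\<in>I. d i * v q i) = 0" using x d QQ by (auto simp: row_kernel_def)
    hence "\<forall>i\<in>I. d i = 0" using col_indepD[OF I(2)] by blast
    thus ?thesis using d by (simp add: row_kernel_def)
  qed
  thus "row_kernel v n Q = row_kernel v n Q'" using row_kernel_mono[OF QQ] by blast
qed

text \<open>If one of the functionals does not vanish on the common kernel of the previous ones, subtract a
  multiple of it.\<close>
lemma row_kernel_imp_span:
  assumes "\<And>x. x \<in> row_kernel v n Q \<Longrightarrow> (\<Sum>b<n. g b * x b) = 0"
  shows "\<exists>\<alpha>. \<forall>b<n. g b = (\<Sum>q<Q. \<alpha> q * v q b)"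
  using assms
proof (induction Q arbitrary: g)
  case 0
  have "g b = 0" if "b < n" for b
    using 0[of "\<lambda>c. if c = b then 1 else 0"] that
    by (simp add: row_kernel_def if_distrib[of "\<lambda>x. _ * x"] sum.delta cong: if_cong)
  thus ?case by simp
next
  case (Suc Q)
  show ?case
  proof (cases "\<forall>x\<in>row_kernel v n Q. (\<Sum>b<n. v Q b * x b) = 0")
    case True
    hence "row_kernel v n Q \<subseteq> row_kernel v n (Suc Q)" by (auto simp: row_kernel_def less_Suc_eq)
    with Suc obtain \<alpha> where "\<forall>b<n. g b = (\<Sum>q<Q. \<alpha> q * v q b)" by blast
    hence "\<forall>b<n. g b = (\<Sum>q<Suc Q. (\<alpha>(Q := 0)) q * v q b)" by simp
    thus ?thesis by blast
  next
    case False
    then obtain z where z: "z \<in> row_kernel v n Q" "(\<Sum>b<n. v Q b * z b) \<noteq> 0" by blast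
    define c where "c = (\<Sum>b<n. v Q b * z b)"
    \<comment> \<open>With this multiple, \<open>g - r * v Q\<close> vanishes at
      \<open>z\<close>.\<close>
    define r where "r = (\<Sum>b<n. g b * z b) / c"
    have "\<exists>\<alpha>. \<forall>b<n. g b - r * v Q b = (\<Sum>q<Q. \<alpha> q * v q b)"
    proof (rule Suc.IH)
      fix x assume x: "x \<in> row_kernel v n Q"
      \<comment> \<open>Subtracting \<open>s\<close> times \<open>z\<close> moves \<open>x\<close>
        into the kernel of row \<open>Q\<close> as well, where the hypothesis on \<open>g\<close>
        applies.\<close>
      define s where "s = (\<Sum>b<n. v Q b * x b) / c"
      have lin: "(\<Sum>b<n. h b * (x b - s * z b)) = (\<Sum>b<n. h b * x b) - s * (\<Sum>b<n. h b * z b)" for h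
        by (simp add: sum_subtractf sum_distrib_left algebra_simps)
      have "(\<lambda>b. x b - s * z b) \<in> row_kernel v n (Suc Q)"
        using x z lin by (auto simp: row_kernel_def less_Suc_eq s_def c_def)
      from Suc.prems[OF this] have "(\<Sum>b<n. g b * x b) = s * (\<Sum>b<n. g b * z b)" using lin by simp
      also have "\<dots> = r * (\<Sum>b<n. v Q b * x b)" by (simp add: r_def s_def)
      finally show "(\<Sum>b<n. (g b - r * v Q b) * x b) = 0"
        by (simp add: sum_subtractf sum_distrib_left algebra_simps)
    qed
    then obtain \<alpha> where "\<forall>b<n. g b - r * v Q b = (\<Sum>q<Q. \<alpha> q * v q b)" by blast
    hence "\<forall>b<n. g b = (\<Sum>q<Suc Q. (\<alpha>(Q := r)) q * v q b)" by (simp add: algebra_simps)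
    thus ?thesis by blast
  qed
qed

text \<open>Dual form of lying outside the span of the previous rows: the row does not vanish on
  their common kernel. A row that is not new is in their span by
  \<open>row_kernel_imp_span\<close>.\<close>

definition new_row :: "(nat \<Rightarrow> nat \<Rightarrow> real) \<Rightarrow> nat \<Rightarrow> nat \<Rightarrow> bool" where
  "new_row v n q \<longleftrightarrow> (\<exists>x\<in>row_kernel v n q. (\<Sum>b<n. v q b * x b) \<noteq> 0)"

lemma row_kernel_Suc_eq_iff: "row_kernel v n (Suc q) = row_kernel v n q \<longleftrightarrow> \<not> new_row v n q"
  unfolding new_row_def row_kernel_def by (auto simp: less_Suc_eq)

lemma row_kernel_eq_iff_no_new_row:
  assumes "Q \<le> Q'"
  shows "row_kernel v n Q = row_kernel v n Q' \<longleftrightarrow> (\<forall>q\<in>{Q..<Q'}. \<not> new_row v n q)"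
  using assms
proof (induction Q' rule: dec_induct)
  case base
  thus ?case by simp
next
  case (step k)
  have "row_kernel v n (Suc k) \<subseteq> row_kernel v n k" "row_kernel v n k \<subseteq> row_kernel v n Q"
    using row_kernel_mono step by (simp_all add: row_kernel_mono)
  hence "row_kernel v n Q = row_kernel v n (Suc k) \<longleftrightarrow>
      row_kernel v n Q = row_kernel v n k \<and> row_kernel v n (Suc k) = row_kernel v n k" by blast
  also have "\<dots> \<longleftrightarrow> (\<forall>q\<in>{Q..<Suc k}. \<not> new_row v n q)"
    using step by (auto simp: row_kernel_Suc_eq_iff less_Suc_eq)
  finally show ?case .
qed

text \<open>Each new row shrinks the kernel strictly and therefore raises the rank by at least
  one.\<close>

lemma card_new_rows_le_mat_rank:
  "card {q. q < Q \<and> new_row v n q} \<le> mat_rank (mat Q n (\<lambda>(q,b). v q b))"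
proof (induction Q)
  case 0
  thus ?case by simp
next
  case (Suc Q)
  let ?r = "\<lambda>Q. mat_rank (mat Q n (\<lambda>(q,b). v q b))"
  have mono: "?r Q \<le> ?r (Suc Q)" by (rule mat_rank_mat_mono) simp
  show ?case
  proof (cases "new_row v n Q")
    case True
    have "?r Q \<noteq> ?r (Suc Q)"
      using True row_kernel_Suc_eq_iff[of v n Q] mat_rank_eq_iff_row_kernel[of Q "Suc Q" n v] by auto
    moreover have "{q. q < Suc Q \<and> new_row v n q} = insert Q {q. q < Q \<and> new_row v n q}"
      using True by (auto simp: less_Suc_eq)
    ultimately show ?thesis using Suc mono by simp
  next
    case False
    have "{q. q < Suc Q \<and> new_row v n q} = {q. q < Q \<and> new_row v n q}"
      using False by (auto simp: less_Suc_eq)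
    thus ?thesis using Suc mono by simp
  qed
qed

lemma card_new_rows_le: "card {q. q < Q \<and> new_row v n q} \<le> n"
  using card_new_rows_le_mat_rank mat_rank_mat_le by (rule order_trans)

text \<open>The bound \<open>n\<close> is uniform in the number of rows, so it passes to the
  infinite stack.\<close>

lemma finite_new_rows: "finite {q. new_row v n q}" and card_all_new_rows_le: "card {q. new_row v n q} \<le> n"
proof -
  let ?J = "{q. new_row v n q}"
  have le: "card F \<le> n" if F: "finite F" "F \<subseteq> ?J" for F
  proof -
    obtain Q where "\<forall>q\<in>F. q < Q" using F(1) finite_nat_set_iff_bounded by blast
    hence "F \<subseteq> {q. q < Q \<and> new_row v n q}" using F(2) by auto
    hence "card F \<le> card {q. q < Q \<and> new_row v n q}" by (intro card_mono) auto
    thus ?thesis using card_new_rows_le[of Q v n] by simp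
  qed
  show fin: "finite ?J"
  proof (rule ccontr)
    assume "infinite ?J"
    from infinite_arbitrarily_large[OF this, of "Suc n"] le show False by fastforce
  qed
  show "card ?J \<le> n" using le[OF fin] by simp
qed

section \<open>Observability matrix and lag\<close>

text \<open>Row \<open>q\<close> of the infinite observability matrix, in the stacking order of \<^const>\<open>obs_mat\<close>.\<close>
definition obs_row :: "real mat \<Rightarrow> real mat \<Rightarrow> nat \<Rightarrow> nat \<Rightarrow> nat \<Rightarrow> real" where
  "obs_row C A p q b = (C * A ^\<^sub>m (q div p)) $$ (q mod p, b)"

lemma obs_mat_eq:
  assumes A: "A \<in> carrier_mat n n" and C: "C \<in> carrier_mat p n"
  shows "obs_mat C A k = mat (k * p) n (\<lambda>(q, b). obs_row C A p q b)"
proof (induction k)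
  case 0
  thus ?case using A by (intro eq_matI) auto
next
  case (Suc k)
  have CA: "C * A ^\<^sub>m k \<in> carrier_mat p n" using A C by (simp add: pow_carrier_mat)
  have *: "(q - k * p) = q mod p \<and> q div p = k" if "\<not> q < k * p" "q < p + k * p" for q
  proof -
    have "q div p = k" using that by (intro div_nat_eqI) (simp_all add: mult.commute)
    thus ?thesis by (metis minus_div_mult_eq_mod)
  qed
  show ?case unfolding obs_mat.simps Suc
  proof (rule eq_matI, goal_cases)
    case (1 q b)
    hence q: "q < p + k * p" and b: "b < n" by auto
    show ?case
    proof (cases "q < k * p")
      case True
      thus ?thesis using q b CA by (simp add: append_rows_def)
    next
      case False
      from * [OF False q] have e: "q - k * p = q mod p" "q div p = k" by simp_all
      show ?thesis using False q b CA C by (simp add: append_rows_def obs_row_def e minus_div_mult_eq_mod)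
    qed
  qed (use CA in \<open>auto simp: append_rows_def\<close>)
qed

lemma index_mult_mat_sum:
  assumes "M \<in> carrier_mat a n" "N \<in> carrier_mat n b" "i < a" "j < b"
  shows "(M * N) $$ (i, j) = (\<Sum>k<n. M $$ (i, k) * N $$ (k, j))"
  using assms by (simp add: scalar_prod_def lessThan_atLeast0)

text \<open>Going one block down multiplies the row by \<open>A\<close> from the right.\<close>

lemma obs_row_add:
  assumes A: "A \<in> carrier_mat n n" and C: "C \<in> carrier_mat p n" and p: "p \<ge> 1" and b: "b < n"
  shows "obs_row C A p (q + p) b = (\<Sum>a<n. obs_row C A p q a * A $$ (a, b))"
proof -
  have CA: "C * A ^\<^sub>m k \<in> carrier_mat p n" for k using A C by (simp add: pow_carrier_mat)
  have d: "(q + p) div p = Suc (q div p)" "(q + p) mod p = q mod p" "q mod p < p" using p by simp_all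
  have "C * A ^\<^sub>m (Suc (q div p)) = (C * A ^\<^sub>m (q div p)) * A"
    using A C by (simp add: assoc_mult_mat[OF C, of _ n A n] pow_carrier_mat)
  hence "obs_row C A p (q + p) b = ((C * A ^\<^sub>m (q div p)) * A) $$ (q mod p, b)"
    unfolding obs_row_def d by simp
  also have "\<dots> = (\<Sum>a<n. (C * A ^\<^sub>m (q div p)) $$ (q mod p, a) * A $$ (a, b))"
    by (rule index_mult_mat_sum[OF CA A d(3) b])
  finally show ?thesis unfolding obs_row_def .
qed

lemma obs_row_less:
  assumes "A \<in> carrier_mat n n" "C \<in> carrier_mat p n" "q < p"
  shows "obs_row C A p q b = C $$ (q, b)"
  using assms by (simp add: obs_row_def)

text \<open>The map sending \<open>q\<close> to \<open>q div p\<close> covers all block numbers from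
  \<open>a\<close> to \<open>b - 1\<close>.\<close>

lemma blocks_card_le:
  fixes p a b :: nat
  assumes "finite J" and J: "\<And>s. a \<le> s \<Longrightarrow> s < b \<Longrightarrow> \<exists>q\<in>J. s * p \<le> q \<and> q < Suc s * p"
  shows "b - a \<le> card {q\<in>J. a * p \<le> q}"
proof -
  have "{a..<b} \<subseteq> (\<lambda>q. q div p) ` {q\<in>J. a * p \<le> q}"
  proof
    fix s assume s: "s \<in> {a..<b}"
    then obtain q where q: "q \<in> J" "s * p \<le> q" "q < Suc s * p" using J by auto
    have "q div p = s" using q by (intro div_nat_eqI) (auto simp: mult.commute)
    moreover have "a * p \<le> q" using s q by (meson atLeastLessThan_iff le_trans mult_le_mono1)
    ultimately show "s \<in> (\<lambda>q. q div p) ` {q\<in>J. a * p \<le> q}" using q(1) by blast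
  qed
  from surj_card_le[OF _ this] assms(1) show ?thesis by simp
qed

text \<open>Appending a block keeps the rank iff it keeps the kernel, that is, iff the block has no
  new row.\<close>

lemma lag_eq_Least_new_row:
  assumes A: "A \<in> carrier_mat n n" and C: "C \<in> carrier_mat p n"
  shows "lag C A = (LEAST k. \<forall>q\<in>{k * p..<Suc k * p}. \<not> new_row (obs_row C A p) n q)"
proof -
  have "mat_rank (obs_mat C A (Suc k)) = mat_rank (obs_mat C A k) \<longleftrightarrow>
      (\<forall>q\<in>{k * p..<Suc k * p}. \<not> new_row (obs_row C A p) n q)" for k
  proof -
    have le: "k * p \<le> Suc k * p" by simp
    show ?thesis unfolding obs_mat_eq[OF A C] row_kernel_eq_iff_no_new_row[OF le, symmetric]
      mat_rank_eq_iff_row_kernel[OF le, symmetric] by (rule eq_commute)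
  qed
  thus ?thesis unfolding lag_def by simp
qed

text \<open>If each of the blocks 0 to \<open>n\<close> had a new row, there would be more than
  \<open>n\<close> of them. So the minimum defining the lag exists and is at most \<open>n\<close>;
  the other two facts are its attainment and minimality.\<close>

lemma
  assumes A: "A \<in> carrier_mat n n" and C: "C \<in> carrier_mat p n"
  shows lag_le: "lag C A \<le> n"
    and not_new_row_lag: "q \<in> {lag C A * p..<Suc (lag C A) * p} \<Longrightarrow> \<not> new_row (obs_row C A p) n q"
    and new_row_less_lag: "s < lag C A \<Longrightarrow> \<exists>q\<in>{s * p..<Suc s * p}. new_row (obs_row C A p) n q"
proof -
  let ?N = "new_row (obs_row C A p) n"
  let ?P = "\<lambda>k. \<forall>q\<in>{k * p..<Suc k * p}. \<not> ?N q"
  have "\<exists>k\<le>n. ?P k"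
  proof (rule ccontr)
    assume no: "\<not> (\<exists>k\<le>n. ?P k)"
    have "Suc n - 0 \<le> card {q \<in> {q. ?N q}. 0 * p \<le> q}"
    proof (rule blocks_card_le[OF finite_new_rows])
      fix s assume "s < Suc n"
      hence "s \<le> n" by simp
      with no have "\<not> ?P s" by blast
      then obtain q where "q \<in> {s * p..<Suc s * p}" "?N q" by blast
      thus "\<exists>q\<in>{q. ?N q}. s * p \<le> q \<and> q < Suc s * p" by (intro bexI[of _ q]) simp_all
    qed
    moreover have "card {q. ?N q} \<le> n" by (rule card_all_new_rows_le)
    ultimately show False by simp
  qed
  then obtain k where k: "k \<le> n" "?P k" by blast
  show "lag C A \<le> n" unfolding lag_eq_Least_new_row[OF A C] using Least_le[of ?P k] k by linarith
  show "\<not> ?N q" if "q \<in> {lag C A * p..<Suc (lag C A) * p}"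
    using LeastI[of ?P k, OF k(2)] that unfolding lag_eq_Least_new_row[OF A C] by blast
  show "\<exists>q\<in>{s * p..<Suc s * p}. ?N q" if "s < lag C A"
    using not_less_Least[of s ?P] that unfolding lag_eq_Least_new_row[OF A C] by blast
qed

section \<open>Realization of difference equations\<close>

text \<open>Allows states indexed by an arbitrary finite set, such as pairs of an output and a
  position; an enumeration of \<open>P\<close> turns the scalar equations into matrices.\<close>

lemma expl_systemsI:
  fixes w :: "'s \<Rightarrow> nat \<Rightarrow> real"
  assumes P: "finite P" and u: "u \<in> carrier_mat m T" and y: "y \<in> carrier_mat p T"
    and dyn: "\<And>s t. s \<in> P \<Longrightarrow> t < T \<Longrightarrow>
      w s (Suc t) = (\<Sum>r\<in>P. a s r * w r t) + (\<Sum>j<m. b s j * u $$ (j, t))"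
    and out: "\<And>i t. i < p \<Longrightarrow> t < T \<Longrightarrow>
      y $$ (i, t) = (\<Sum>r\<in>P. c i r * w r t) + (\<Sum>j<m. d i j * u $$ (j, t))"
  shows "expl_systems u y (card P) \<noteq> {}"
proof -
  define n where "n = card P"
  obtain e where e: "bij_betw e {..<n} P"
    using ex_bij_betw_nat_finite[OF P] unfolding n_def lessThan_atLeast0 by blast
  have eP: "e i \<in> P" if "i < n" for i using e that by (auto simp: bij_betw_def)
  have re: "(\<Sum>r\<in>P. f r) = (\<Sum>k<n. f (e k))" for f :: "'s \<Rightarrow> real"
    by (rule sum.reindex_bij_betw[OF e, symmetric])
  define A where "A = mat n n (\<lambda>(i, k). a (e i) (e k))"
  define B where "B = mat n m (\<lambda>(i, j). b (e i) j)"
  define C where "C = mat p n (\<lambda>(i, k). c i (e k))"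
  define D where "D = mat p m (\<lambda>(i, j). d i j)"
  define x where "x = mat n (T + 1) (\<lambda>(i, t). w (e i) t)"
  have car: "A \<in> carrier_mat n n" "B \<in> carrier_mat n m" "C \<in> carrier_mat p n" "D \<in> carrier_mat p m"
    "x \<in> carrier_mat n (T + 1)" by (simp_all add: A_def B_def C_def D_def x_def)
  have "col x (t + 1) = A *\<^sub>v col x t + B *\<^sub>v col u t" if t: "t < T" for t
  proof (rule eq_vecI)
    fix i assume "i < dim_vec (A *\<^sub>v col x t + B *\<^sub>v col u t)"
    hence i: "i < n" using car by simp
    show "col x (t + 1) $ i = (A *\<^sub>v col x t + B *\<^sub>v col u t) $ i"
      using i t u dyn[OF eP[OF i] t]
      by (simp add: re scalar_prod_def A_def B_def x_def lessThan_atLeast0)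
  qed (use car in auto)
  moreover have "col y t = C *\<^sub>v col x t + D *\<^sub>v col u t" if t: "t < T" for t
  proof (rule eq_vecI)
    fix i assume "i < dim_vec (C *\<^sub>v col x t + D *\<^sub>v col u t)"
    hence i: "i < p" using car by simp
    show "col y t $ i = (C *\<^sub>v col x t + D *\<^sub>v col u t) $ i"
      using i t u y out[OF i t]
      by (simp add: re scalar_prod_def C_def D_def x_def lessThan_atLeast0)
  qed (use car y in auto)
  ultimately have "explains u y (A, B, C, D)" using car u by auto
  \<comment> \<open>\<open>systems\<close> restricts the lag to at most \<open>n\<close>, which
    \<open>lag_le\<close> provides.\<close>
  moreover have "(A, B, C, D) \<in> systems m p n"
    unfolding systems_def systems_lag_def using car lag_le[OF car(1,3)] by auto
  ultimately have "(A, B, C, D) \<in> expl_systems u y n" using u y by (simp add: expl_systems_def)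
  thus ?thesis unfolding n_def by blast
qed

lemma sum_lessThan_add: "(\<Sum>q<a + b. f q) = (\<Sum>q<a. f q) + (\<Sum>k<b. f (a + k :: nat) :: real)"
  by (induction b) (simp_all add: add.assoc)

lemma sum_lessThan_blocks:
  "(\<Sum>q<k * p. f q) = (\<Sum>s<k. \<Sum>i<p. f (s * p + i :: nat) :: real)"
proof (induction k)
  case (Suc k)
  have "(\<Sum>q<Suc k * p. f q) = (\<Sum>q<k * p + p. f q)" by (simp add: add.commute)
  thus ?case using Suc by (simp only: sum_lessThan_add sum.lessThan_Suc)
qed simp

text \<open>Forward substitution. \<open>R\<close> is fixed before \<open>z\<close>, so the same
  matrix can be applied at every time.\<close>

lemma unit_lower_triangular_inverse:
  fixes L :: "nat \<Rightarrow> nat \<Rightarrow> real"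
  obtains R where "\<And>i z. i < p \<Longrightarrow> z i = (\<Sum>j<p. R i j * (z j - (\<Sum>k<j. L j k * z k)))"
proof -
  have "\<exists>g. \<forall>z. z i = (\<Sum>j<p. g j * (z j - (\<Sum>k<j. L j k * z k)))" if "i < p" for i
    using that
  proof (induction i rule: less_induct)
    case (less i)
    have "\<forall>k. \<exists>g. k < i \<longrightarrow> (\<forall>z. z k = (\<Sum>j<p. g j * (z j - (\<Sum>k<j. L j k * z k))))"
      using less by simp
    from choice[OF this] obtain g
      where g: "\<And>k z. k < i \<Longrightarrow> z k = (\<Sum>j<p. g k j * (z j - (\<Sum>k<j. L j k * z k)))" by blast
    \<comment> \<open>Row \<open>i\<close> of the inverse: the unit row plus the earlier rows
      \<open>g k\<close> weighted by \<open>L i k\<close>.\<close>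
    have "z i = (\<Sum>j<p. ((if j = i then 1 else 0) + (\<Sum>k<i. L i k * g k j)) * (z j - (\<Sum>k<j. L j k * z k)))" for z
    proof -
      let ?z = "\<lambda>j. z j - (\<Sum>k<j. L j k * z k)"
      have "(\<Sum>j<p. ((if j = i then 1 else 0) + (\<Sum>k<i. L i k * g k j)) * ?z j)
          = (\<Sum>j<p. if j = i then ?z j else 0) + (\<Sum>j<p. \<Sum>k<i. L i k * (g k j * ?z j))"
        unfolding sum.distrib[symmetric]
        by (intro sum.cong) (auto simp: distrib_right sum_distrib_right mult.assoc)
      also have "(\<Sum>j<p. if j = i then ?z j else 0) = ?z i" using less.prems by (simp add: sum.delta)
      also have "(\<Sum>j<p. \<Sum>k<i. L i k * (g k j * ?z j)) = (\<Sum>k<i. L i k * (\<Sum>j<p. g k j * ?z j))"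
        by (subst sum.swap) (simp add: sum_distrib_left)
      also have "\<dots> = (\<Sum>k<i. L i k * z k)" by (intro sum.cong refl) (use g in auto)
      finally show ?thesis by simp
    qed
    thus ?case by (intro exI[of _ "\<lambda>j. (if j = i then 1 else 0) + (\<Sum>k<i. L i k * g k j)"]) blast
  qed
  hence "\<forall>i. \<exists>g. i < p \<longrightarrow> (\<forall>z. z i = (\<Sum>j<p. g j * (z j - (\<Sum>k<j. L j k * z k))))" by simp
  from choice[OF this] that show thesis by blast
qed

text \<open>After the unit lower triangular change of output coordinates \<open>z\<close>, the difference equations
  are solved for the leading terms \<open>z\<^sub>i(t + \<mu>\<^sub>i)\<close>, and the observer canonical form
  realizes them. Its state \<open>w i k t\<close> is given in closed form; the initial state is chosen to fit
  the first \<open>\<mu>\<^sub>i\<close> samples of \<open>z\<^sub>i\<close>.\<close>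
lemma realization:
  assumes u: "u \<in> carrier_mat m T" and y: "y \<in> carrier_mat p T"
    and rel: "\<And>i t. i < p \<Longrightarrow> t + \<mu> i < T \<Longrightarrow>
      y $$ (i, t + \<mu> i) = (\<Sum>q<\<mu> i * p + i. \<alpha> i q * y $$ (q mod p, t + q div p))
        + (\<Sum>s\<le>\<mu> i. \<Sum>j<m. \<beta> i s j * u $$ (j, t + s))"
  shows "expl_systems u y (\<Sum>i<p. \<mu> i) \<noteq> {}"
proof -
  \<comment> \<open>The terms moved to the left are those of \<open>rel\<close> at the leading time
    \<open>t + \<mu> i\<close>, which involve only outputs before \<open>i\<close>.\<close>
  define z where "z i t = y $$ (i, t) - (\<Sum>k<i. \<alpha> i (\<mu> i * p + k) * y $$ (k, t))" for i t
  obtain R where R: "\<And>i f. i < p \<Longrightarrow> f i = (\<Sum>j<p. R i j * (f j - (\<Sum>k<j. \<alpha> j (\<mu> j * p + k) * f k)))"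
    by (rule unit_lower_triangular_inverse[of p "\<lambda>j k. \<alpha> j (\<mu> j * p + k)"]) blast
  have yz: "y $$ (i, t) = (\<Sum>j<p. R i j * z j t)" if "i < p" for i t
    using R[OF that, of "\<lambda>i. y $$ (i, t)"] by (simp add: z_def)
  \<comment> \<open>\<open>F i r\<close> collects the terms of equation \<open>i\<close> with time
    shift \<open>r\<close>, evaluated at absolute time \<open>t\<close>; \<open>H\<close> is the
    input term at the leading time.\<close>
  define F where "F i r t = (\<Sum>l<p. \<alpha> i (r * p + l) * y $$ (l, t)) + (\<Sum>j<m. \<beta> i r j * u $$ (j, t))" for i r t
  define H where "H i t = (\<Sum>j<m. \<beta> i (\<mu> i) j * u $$ (j, t))" for i t
  have zrel: "z i (t + \<mu> i) = (\<Sum>r<\<mu> i. F i r (t + r)) + H i (t + \<mu> i)" if i: "i < p" and t: "t + \<mu> i < T" for i t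
  proof -
    have p: "p > 0" using i by simp
    have "y $$ (i, t + \<mu> i) = (\<Sum>q<\<mu> i * p + i. \<alpha> i q * y $$ (q mod p, t + q div p))
        + (\<Sum>s\<le>\<mu> i. \<Sum>j<m. \<beta> i s j * u $$ (j, t + s))" by (rule rel[OF i t])
    also have "(\<Sum>q<\<mu> i * p + i. \<alpha> i q * y $$ (q mod p, t + q div p))
       = (\<Sum>s<\<mu> i. \<Sum>l<p. \<alpha> i (s * p + l) * y $$ (l, t + s)) + (\<Sum>k<i. \<alpha> i (\<mu> i * p + k) * y $$ (k, t + \<mu> i))"
      unfolding sum_lessThan_add sum_lessThan_blocks
      using i p by (intro arg_cong2[of _ _ _ _ "(+)"] sum.cong refl) auto
    also have "(\<Sum>s\<le>\<mu> i. \<Sum>j<m. \<beta> i s j * u $$ (j, t + s))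
       = (\<Sum>s<\<mu> i. \<Sum>j<m. \<beta> i s j * u $$ (j, t + s)) + H i (t + \<mu> i)"
      unfolding lessThan_Suc_atMost[symmetric] H_def by simp
    finally show ?thesis unfolding z_def F_def sum.distrib by simp
  qed
  \<comment> \<open>Position \<open>k\<close> is \<open>k\<close> steps from the output, so it
    receives the shift \<open>\<mu> i - 1 - k\<close>. The default 0 makes the register end at
    position \<open>\<mu> i\<close>.\<close>
  define G where "G i k t = (if k < \<mu> i then F i (\<mu> i - 1 - k) t else 0)" for i k t
  define w0 where "w0 i k = (if k < \<mu> i then z i k - H i k - (\<Sum>s<k. G i (k - 1 - s) s) else 0)" for i k
  \<comment> \<open>The shift register unrolled: the content of position \<open>k\<close> at time
    \<open>t\<close> started at position \<open>k + t\<close> and collected \<open>G\<close> on its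
    way.\<close>
  define w where "w i k t = w0 i (k + t) + (\<Sum>s<t. G i (k + t - 1 - s) s)" for i k t
  have w_Suc: "w i k (Suc t) = w i (Suc k) t + G i k t" for i k t
    by (simp add: w_def)
  have w_top: "w i k t = 0" if "k \<ge> \<mu> i" for i k t
    using that by (auto simp: w_def w0_def G_def intro!: sum.neutral)
  have w_out: "z i t = w i 0 t + H i t" if i: "i < p" and t: "t < T" for i t
  proof (cases "t < \<mu> i")
    case True
    thus ?thesis by (simp add: w_def w0_def)
  next
    case False
    then obtain t' where t': "t = t' + \<mu> i" by (metis add.commute le_Suc_ex not_less)
    have "w i 0 t = (\<Sum>s<t' + \<mu> i. G i (t' + \<mu> i - 1 - s) s)" using t' by (simp add: w_def w0_def)
    also have "\<dots> = (\<Sum>r<\<mu> i. F i r (t' + r))"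
    proof -
      \<comment> \<open>These inputs would have to enter at a position at or beyond
        \<open>\<mu> i\<close>, where \<open>G\<close> is 0.\<close>
      have "(\<Sum>s<t'. G i (t' + \<mu> i - 1 - s) s) = 0"
        by (intro sum.neutral) (auto simp: G_def)
      moreover have "G i (t' + \<mu> i - 1 - (t' + r)) (t' + r) = F i r (t' + r)" if "r < \<mu> i" for r
      proof -
        have "t' + \<mu> i - 1 - (t' + r) = \<mu> i - 1 - r" "\<mu> i - 1 - (\<mu> i - 1 - r) = r" "\<mu> i - 1 - r < \<mu> i"
          using that by simp_all
        thus ?thesis unfolding G_def by simp
      qed
      ultimately show ?thesis unfolding sum_lessThan_add by simp
    qed
    finally show ?thesis using zrel[OF i, of t'] t t' by simp
  qed
  define P where "P = Sigma {..<p} (\<lambda>i. {..<\<mu> i})"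
  \<comment> \<open>The outputs are recovered as \<open>R\<close> applied to \<open>z\<close>, where
    \<open>z j\<close> is register position 0 plus \<open>H j\<close>.\<close>
  define c where "c i = (\<lambda>(j, k). if k = (0::nat) then R i j else 0)" for i
  define d where "d i h = (\<Sum>j<p. R i j * \<beta> j (\<mu> j) h)" for i h
  \<comment> \<open>Shift plus feedback: the outputs occurring in \<open>F\<close> are replaced by
    their expressions through \<open>c\<close> and \<open>d\<close>.\<close>
  define a where "a = (\<lambda>(i, k) r. (if r = (i, Suc k) then 1 else 0) +
    (\<Sum>l<p. \<alpha> i ((\<mu> i - 1 - k) * p + l) * c l r))"
  define b where "b = (\<lambda>(i, k) h. \<beta> i (\<mu> i - 1 - k) h + (\<Sum>l<p. \<alpha> i ((\<mu> i - 1 - k) * p + l) * d l h))"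
  let ?w = "\<lambda>(i, k). w i k"
  have finP: "finite P" unfolding P_def by auto
  have out: "y $$ (i, t) = (\<Sum>r\<in>P. c i r * ?w r t) + (\<Sum>j<m. d i j * u $$ (j, t))"
    if i: "i < p" and t: "t < T" for i t
  proof -
    have "(\<Sum>r\<in>P. c i r * ?w r t) = (\<Sum>j<p. \<Sum>k<\<mu> j. if k = 0 then R i j * w j 0 t else 0)"
      unfolding P_def by (subst sum.Sigma) (auto simp: c_def intro!: sum.cong)
    \<comment> \<open>If \<open>\<mu> j = 0\<close>, there is no state \<open>(j, 0)\<close>, but
      then \<open>w j 0 t\<close> is 0 by \<open>w_top\<close>.\<close>
    also have "\<dots> = (\<Sum>j<p. R i j * w j 0 t)"
      using w_top[of _ 0] by (intro sum.cong refl) (auto simp: sum.delta)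
    finally have 1: "(\<Sum>r\<in>P. c i r * ?w r t) = (\<Sum>j<p. R i j * w j 0 t)" .
    have "(\<Sum>j<m. d i j * u $$ (j, t)) = (\<Sum>j<p. R i j * H j t)"
      unfolding d_def H_def sum_distrib_left sum_distrib_right mult.assoc by (rule sum.swap)
    moreover have "(\<Sum>j<p. R i j * z j t) = (\<Sum>j<p. R i j * (w j 0 t + H j t))"
      using w_out t by (intro sum.cong refl) auto
    ultimately show ?thesis unfolding yz[OF i] 1 by (simp only: distrib_left sum.distrib)
  qed
  have dyn: "?w s (Suc t) = (\<Sum>r\<in>P. a s r * ?w r t) + (\<Sum>j<m. b s j * u $$ (j, t))"
    if s: "s \<in> P" and t: "t < T" for s t
  proof -
    obtain i k where ik: "s = (i, k)" "i < p" "k < \<mu> i" using s by (auto simp: P_def)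
    let ?al = "\<lambda>l. \<alpha> i ((\<mu> i - 1 - k) * p + l)"
    \<comment> \<open>At the last position \<open>(i, Suc k)\<close> is outside \<open>P\<close>,
      and \<open>w_top\<close> gives the value 0.\<close>
    have shift: "(\<Sum>r\<in>P. if r = (i, Suc k) then ?w r t else 0) = w i (Suc k) t"
      using finP ik w_top[of i "Suc k" t] by (auto simp: sum.delta P_def)
    have "(\<Sum>r\<in>P. a s r * ?w r t) = (\<Sum>r\<in>P. (if r = (i, Suc k) then ?w r t else 0) + (\<Sum>l<p. ?al l * (c l r * ?w r t)))"
      unfolding a_def ik(1) by (intro sum.cong refl) (auto simp: distrib_right sum_distrib_right mult.assoc)
    also have "\<dots> = w i (Suc k) t + (\<Sum>l<p. ?al l * (\<Sum>r\<in>P. c l r * ?w r t))"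
      unfolding sum.distrib shift by (subst sum.swap) (simp add: sum_distrib_left)
    finally have A: "(\<Sum>r\<in>P. a s r * ?w r t) = w i (Suc k) t + (\<Sum>l<p. ?al l * (\<Sum>r\<in>P. c l r * ?w r t))" .
    have "(\<Sum>j<m. b s j * u $$ (j, t)) = (\<Sum>j<m. \<beta> i (\<mu> i - 1 - k) j * u $$ (j, t)) +
        (\<Sum>j<m. \<Sum>l<p. ?al l * (d l j * u $$ (j, t)))"
      unfolding b_def ik(1) sum.distrib[symmetric]
      by (intro sum.cong refl) (auto simp: distrib_right sum_distrib_right mult.assoc)
    also have "(\<Sum>j<m. \<Sum>l<p. ?al l * (d l j * u $$ (j, t))) = (\<Sum>l<p. ?al l * (\<Sum>j<m. d l j * u $$ (j, t)))"
      by (subst sum.swap) (simp add: sum_distrib_left)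
    finally have B: "(\<Sum>j<m. b s j * u $$ (j, t)) = (\<Sum>j<m. \<beta> i (\<mu> i - 1 - k) j * u $$ (j, t)) +
        (\<Sum>l<p. ?al l * (\<Sum>j<m. d l j * u $$ (j, t)))" .
    have "(\<Sum>l<p. ?al l * y $$ (l, t)) = (\<Sum>l<p. ?al l * (\<Sum>r\<in>P. c l r * ?w r t)) + (\<Sum>l<p. ?al l * (\<Sum>j<m. d l j * u $$ (j, t)))"
      unfolding sum.distrib[symmetric] distrib_left[symmetric] using out t by (intro sum.cong refl) auto
    thus ?thesis unfolding A B using ik by (simp add: w_Suc G_def F_def)
  qed
  have "card P = (\<Sum>i<p. \<mu> i)" unfolding P_def by simp
  with expl_systemsI[OF finP u y dyn out] show ?thesis by simp
qed

section \<open>Difference equations satisfied by the data\<close>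

text \<open>The equation of row \<open>q - p\<close>, taken one time step later, becomes that of row
  \<open>q\<close> by the state equation. The vanishing of \<open>M\<close> past
  \<open>q div p\<close> lets equations of different delays be summed over a common range.\<close>

lemma output_equation:
  assumes A: "A \<in> carrier_mat n n" and B: "B \<in> carrier_mat n m"
    and C: "C \<in> carrier_mat p n" and D: "D \<in> carrier_mat p m" and p: "p \<ge> 1"
    and st: "\<And>a t. a < n \<Longrightarrow> t < T \<Longrightarrow>
      x a (Suc t) = (\<Sum>b<n. A $$ (a, b) * x b t) + (\<Sum>j<m. B $$ (a, j) * u $$ (j, t))"
    and out: "\<And>i t. i < p \<Longrightarrow> t < T \<Longrightarrow>
      y $$ (i, t) = (\<Sum>b<n. C $$ (i, b) * x b t) + (\<Sum>j<m. D $$ (i, j) * u $$ (j, t))"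
  shows "\<exists>M. (\<forall>s j. q div p < s \<longrightarrow> M s j = 0) \<and> (\<forall>t. t + q div p < T \<longrightarrow>
    y $$ (q mod p, t + q div p) = (\<Sum>b<n. obs_row C A p q b * x b t)
      + (\<Sum>s\<le>q div p. \<Sum>j<m. M s j * u $$ (j, t + s)))"
proof (induction q rule: less_induct)
  case (less q)
  show ?case
  proof (cases "q < p")
    case True
    have "y $$ (q, t) = (\<Sum>b<n. obs_row C A p q b * x b t) + (\<Sum>j<m. D $$ (q, j) * u $$ (j, t))"
      if "t < T" for t
      using out[OF True that] obs_row_less[OF A C True] by simp
    thus ?thesis using True by (intro exI[of _ "\<lambda>s j. if s = 0 then D $$ (q, j) else 0"]) simp
  next
    case False
    define k where "k = q - p"
    have q: "q = k + p" and kq: "k < q" using False p by (auto simp: k_def)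
    have dm: "q div p = Suc (k div p)" "q mod p = k mod p" using p q by simp_all
    obtain M where M0: "\<And>s j. k div p < s \<Longrightarrow> M s j = 0" and M: "\<And>t. t + k div p < T \<Longrightarrow>
      y $$ (k mod p, t + k div p) = (\<Sum>b<n. obs_row C A p k b * x b t)
        + (\<Sum>s\<le>k div p. \<Sum>j<m. M s j * u $$ (j, t + s))"
      using less[OF kq] by blast
    \<comment> \<open>The later start shifts the old input coefficients by one; the new one at shift
      0 comes from \<open>B\<close> in the state equation.\<close>
    define N where "N s j = (case s of 0 \<Rightarrow> \<Sum>a<n. obs_row C A p k a * B $$ (a, j) | Suc r \<Rightarrow> M r j)" for s j
    have "y $$ (q mod p, t + q div p) = (\<Sum>b<n. obs_row C A p q b * x b t)
      + (\<Sum>s\<le>q div p. \<Sum>j<m. N s j * u $$ (j, t + s))" if t: "t + q div p < T" for t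
    proof -
      have tT: "Suc t + k div p < T" "t < T" using t dm by auto
      have "(\<Sum>a<n. obs_row C A p k a * x a (Suc t)) = (\<Sum>a<n. \<Sum>b<n. obs_row C A p k a * A $$ (a, b) * x b t)
          + (\<Sum>a<n. \<Sum>j<m. obs_row C A p k a * B $$ (a, j) * u $$ (j, t))"
        unfolding sum.distrib[symmetric] using st tT
        by (intro sum.cong refl) (simp add: distrib_left sum_distrib_left mult.assoc)
      also have "(\<Sum>a<n. \<Sum>b<n. obs_row C A p k a * A $$ (a, b) * x b t) = (\<Sum>b<n. obs_row C A p q b * x b t)"
        unfolding q by (subst sum.swap) (simp add: obs_row_add[OF A C p] sum_distrib_right)
      also have "(\<Sum>a<n. \<Sum>j<m. obs_row C A p k a * B $$ (a, j) * u $$ (j, t)) = (\<Sum>j<m. N 0 j * u $$ (j, t + 0))"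
        by (subst sum.swap) (simp add: N_def sum_distrib_right)
      finally have 1: "(\<Sum>a<n. obs_row C A p k a * x a (Suc t)) =
        (\<Sum>b<n. obs_row C A p q b * x b t) + (\<Sum>j<m. N 0 j * u $$ (j, t + 0))" .
      have "y $$ (q mod p, t + q div p) = y $$ (k mod p, Suc t + k div p)" by (simp add: dm)
      also have "\<dots> = (\<Sum>b<n. obs_row C A p q b * x b t) + ((\<Sum>j<m. N 0 j * u $$ (j, t + 0))
         + (\<Sum>s\<le>k div p. \<Sum>j<m. N (Suc s) j * u $$ (j, t + Suc s)))"
        unfolding M[OF tT(1)] 1 by (simp add: N_def)
      also have "(\<Sum>j<m. N 0 j * u $$ (j, t + 0)) + (\<Sum>s\<le>k div p. \<Sum>j<m. N (Suc s) j * u $$ (j, t + Suc s))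
         = (\<Sum>s\<le>q div p. \<Sum>j<m. N s j * u $$ (j, t + s))"
        unfolding dm(1) by (rule sum.atMost_Suc_shift[symmetric])
      finally show ?thesis .
    qed
    moreover have "N s j = 0" if "q div p < s" for s j
      using that M0 unfolding N_def dm by (cases s) auto
    ultimately show ?thesis by (intro exI[of _ N]) blast
  qed
qed

text \<open>Row \<open>q\<close> is a combination of earlier rows; subtracting the same combination
  of their output equations eliminates the state.\<close>

lemma data_relation:
  assumes S: "(A, B, C, D) \<in> expl_systems_lag u y l n" and p: "p \<ge> 1"
    and u: "u \<in> carrier_mat m T" and y: "y \<in> carrier_mat p T"
    and old: "\<not> new_row (obs_row C A p) n q"
  shows "\<exists>\<alpha> \<beta>. \<forall>t. t + q div p < T \<longrightarrow>
    y $$ (q mod p, t + q div p) = (\<Sum>k<q. \<alpha> k * y $$ (k mod p, t + k div p))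
      + (\<Sum>s\<le>q div p. \<Sum>j<m. \<beta> s j * u $$ (j, t + s))"
proof -
  have A: "A \<in> carrier_mat n n" and B: "B \<in> carrier_mat n m"
    and C: "C \<in> carrier_mat p n" and D: "D \<in> carrier_mat p m"
    using S u y by (auto simp: expl_systems_lag_def systems_lag_def)
  have "explains u y (A, B, C, D)" using S by (simp add: expl_systems_lag_def)
  then obtain X where X: "X \<in> carrier_mat n (T + 1)" and
    Xs: "\<And>t. t < T \<Longrightarrow> col X (t + 1) = A *\<^sub>v col X t + B *\<^sub>v col u t" and
    Xo: "\<And>t. t < T \<Longrightarrow> col y t = C *\<^sub>v col X t + D *\<^sub>v col u t"
    using A u by auto
  define x where "x a t = X $$ (a, t)" for a t
  have st: "x a (Suc t) = (\<Sum>b<n. A $$ (a, b) * x b t) + (\<Sum>j<m. B $$ (a, j) * u $$ (j, t))"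
    if "a < n" "t < T" for a t
    using arg_cong[OF Xs[OF that(2)], of "\<lambda>v. v $ a"] that A B X u
    by (simp add: x_def scalar_prod_def lessThan_atLeast0)
  have out: "y $$ (i, t) = (\<Sum>b<n. C $$ (i, b) * x b t) + (\<Sum>j<m. D $$ (i, j) * u $$ (j, t))"
    if "i < p" "t < T" for i t
    using arg_cong[OF Xo[OF that(2)], of "\<lambda>v. v $ i"] that C D X u y
    by (simp add: x_def scalar_prod_def lessThan_atLeast0)
  let ?v = "obs_row C A p"
  have "\<forall>q. \<exists>M. (\<forall>s j. q div p < s \<longrightarrow> M s j = 0) \<and> (\<forall>t. t + q div p < T \<longrightarrow>
    y $$ (q mod p, t + q div p) = (\<Sum>b<n. ?v q b * x b t)
      + (\<Sum>s\<le>q div p. \<Sum>j<m. M s j * u $$ (j, t + s)))"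
    using output_equation[OF A B C D p, of T x u y] st out by simp
  from choice[OF this] obtain M where M0: "\<And>q s j. q div p < s \<Longrightarrow> M q s j = 0"
    and M: "\<And>q t. t + q div p < T \<Longrightarrow> y $$ (q mod p, t + q div p) = (\<Sum>b<n. ?v q b * x b t)
      + (\<Sum>s\<le>q div p. \<Sum>j<m. M q s j * u $$ (j, t + s))" by blast
  have "\<exists>\<alpha>. \<forall>b<n. ?v q b = (\<Sum>k<q. \<alpha> k * ?v k b)"
    by (rule row_kernel_imp_span) (use old in \<open>auto simp: new_row_def\<close>)
  then obtain \<alpha> where \<alpha>: "\<And>b. b < n \<Longrightarrow> ?v q b = (\<Sum>k<q. \<alpha> k * ?v k b)" by blast
  define \<beta> where "\<beta> s j = M q s j - (\<Sum>k<q. \<alpha> k * M k s j)" for s j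
  let ?U = "\<lambda>N t. \<Sum>s\<le>q div p. \<Sum>j<m. N s j * u $$ (j, t + s)"
  \<comment> \<open>Rows before \<open>q\<close> have no larger delay, so their equations hold on
    the same time range and their input sums can be padded with zeros.\<close>
  have Mk: "y $$ (k mod p, t + k div p) = (\<Sum>b<n. ?v k b * x b t) + ?U (M k) t"
    if "k \<le> q" "t + q div p < T" for k t
  proof -
    have le: "k div p \<le> q div p" using that by (simp add: div_le_mono)
    have "(\<Sum>s\<le>k div p. \<Sum>j<m. M k s j * u $$ (j, t + s)) = ?U (M k) t"
      using le M0 by (intro sum.mono_neutral_left) auto
    thus ?thesis using M[of t k] le that by simp
  qed
  have "y $$ (q mod p, t + q div p) = (\<Sum>k<q. \<alpha> k * y $$ (k mod p, t + k div p)) + ?U \<beta> t"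
    if t: "t + q div p < T" for t
  proof -
    have "(\<Sum>b<n. ?v q b * x b t) = (\<Sum>b<n. \<Sum>k<q. \<alpha> k * (?v k b * x b t))"
      using \<alpha> by (intro sum.cong refl) (simp add: sum_distrib_right mult.assoc)
    also have "\<dots> = (\<Sum>k<q. \<alpha> k * (\<Sum>b<n. ?v k b * x b t))"
      by (subst sum.swap) (simp add: sum_distrib_left)
    finally have 1: "(\<Sum>b<n. ?v q b * x b t) = (\<Sum>k<q. \<alpha> k * (\<Sum>b<n. ?v k b * x b t))" .
    have "(\<Sum>s\<le>q div p. \<Sum>j<m. (\<Sum>k<q. \<alpha> k * M k s j) * u $$ (j, t + s))
      = (\<Sum>s\<le>q div p. \<Sum>k<q. \<Sum>j<m. \<alpha> k * (M k s j * u $$ (j, t + s)))"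
      unfolding sum_distrib_right mult.assoc by (rule sum.cong[OF refl], rule sum.swap)
    also have "\<dots> = (\<Sum>k<q. \<alpha> k * ?U (M k) t)"
      by (subst sum.swap) (simp add: sum_distrib_left)
    finally have 2: "?U \<beta> t = ?U (M q) t - (\<Sum>k<q. \<alpha> k * ?U (M k) t)"
      unfolding \<beta>_def left_diff_distrib sum_subtractf by simp
    have "(\<Sum>k<q. \<alpha> k * y $$ (k mod p, t + k div p))
      = (\<Sum>k<q. \<alpha> k * (\<Sum>b<n. ?v k b * x b t)) + (\<Sum>k<q. \<alpha> k * ?U (M k) t)"
      unfolding sum.distrib[symmetric] distrib_left[symmetric]
      using Mk t by (intro sum.cong refl) simp
    thus ?thesis using Mk[of q t] t 1 2 by simp
  qed
  thus ?thesis by blast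
qed

section \<open>Combination of the two explaining systems\<close>

theorem mainTheorem4:
  fixes m p T l n :: nat and u y :: "real mat"
  assumes "m \<ge> 1" and "p \<ge> 1" and "T \<ge> 1"
    and "u \<in> carrier_mat m T" and "y \<in> carrier_mat p T"
    and "u \<noteq> 0\<^sub>m m T"
    and "\<exists>n_true. \<exists>S \<in> expl_systems u y n_true. minimal_system S"
    and "expl_systems_lag u y l n \<noteq> {}"
  shows "int l \<le> int n - int (n_min u y) + int (l_min u y)"
proof -
  note p = assms(2) and u = assms(4) and y = assms(5)
  define l' where "l' = l_min u y"
  obtain A B C D where S: "(A, B, C, D) \<in> expl_systems_lag u y l n" using assms(8) by auto
  have "\<exists>n. expl_systems_lag u y l' n \<noteq> {}" unfolding l'_def l_min_def
    using LeastI[of "\<lambda>l. \<exists>n. expl_systems_lag u y l n \<noteq> {}" l] assms(8) by blast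
  then obtain n' A' B' C' D' where S': "(A', B', C', D') \<in> expl_systems_lag u y l' n'" by auto
  have l'l: "l' \<le> l" unfolding l'_def l_min_def using assms(8) by (intro Least_le) blast
  have A: "A \<in> carrier_mat n n" and C: "C \<in> carrier_mat p n" and lag: "lag C A = l"
    using S y by (auto simp: expl_systems_lag_def systems_lag_def)
  have A': "A' \<in> carrier_mat n' n'" and C': "C' \<in> carrier_mat p n'" and lag': "lag C' A' = l'"
    using S' y by (auto simp: expl_systems_lag_def systems_lag_def)
  let ?J = "{q. new_row (obs_row C A p) n q}"
  define K where "K = {q \<in> ?J. q < l' * p}"
  have finK: "finite K" unfolding K_def by simp
  have cardK: "card K + (l - l') \<le> n"
  proof -
    have "l - l' \<le> card {q \<in> ?J. l' * p \<le> q}"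
    proof (rule blocks_card_le[OF finite_new_rows])
      fix s assume "s < l"
      with new_row_less_lag[OF A C] lag obtain q
        where "q \<in> {s * p..<Suc s * p}" "new_row (obs_row C A p) n q" by blast
      thus "\<exists>q\<in>?J. s * p \<le> q \<and> q < Suc s * p" by (intro bexI[of _ q]) simp_all
    qed
    moreover have "card K + card {q \<in> ?J. l' * p \<le> q} = card ?J"
      by (subst card_Un_disjoint[symmetric])
        (use finite_new_rows[of "obs_row C A p" n] in \<open>auto simp: K_def intro: arg_cong[of _ _ card]\<close>)
    ultimately show ?thesis using card_all_new_rows_le[of "obs_row C A p" n] by linarith
  qed
  \<comment> \<open>Using \<open>K\<close> instead of all new rows builds in the cap: no index from
    \<open>l' * p\<close> on belongs to \<open>K\<close>.\<close>
  define \<mu> where "\<mu> i = (LEAST k. k * p + i \<notin> K)" for i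
  have K_less: "k < \<mu> i \<Longrightarrow> k * p + i \<in> K" for k i
    unfolding \<mu>_def using not_less_Least by blast
  have notK: "l' * p + i \<notin> K" for i by (simp add: K_def)
  have K_mu: "\<mu> i * p + i \<notin> K" and mu_le: "\<mu> i \<le> l'" for i
    unfolding \<mu>_def by (rule LeastI[of "\<lambda>k. k * p + i \<notin> K", OF notK],
      rule Least_le[of "\<lambda>k. k * p + i \<notin> K", OF notK])
  have rel: "\<exists>\<alpha> \<beta>. \<forall>t. t + \<mu> i < T \<longrightarrow>
      y $$ (i, t + \<mu> i) = (\<Sum>q<\<mu> i * p + i. \<alpha> q * y $$ (q mod p, t + q div p))
        + (\<Sum>s\<le>\<mu> i. \<Sum>j<m. \<beta> s j * u $$ (j, t + s))" if i: "i < p" for i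
  proof -
    have dm: "(\<mu> i * p + i) div p = \<mu> i" "(\<mu> i * p + i) mod p = i" using i by simp_all
    show ?thesis
    proof (cases "\<mu> i = l'")
      \<comment> \<open>Block \<open>l'\<close> of the system with lag \<open>l'\<close> has no new
        row.\<close>
      case True
      have "\<not> new_row (obs_row C' A' p) n' (\<mu> i * p + i)"
        by (rule not_new_row_lag[OF A' C']) (use i lag' True in auto)
      from data_relation[OF S' p u y this] show ?thesis unfolding dm .
    next
      \<comment> \<open>Here the row lies in a block before \<open>l'\<close>, so being outside
        \<open>K\<close> means that it is not new for the first system.\<close>
      case False
      hence "Suc (\<mu> i) * p \<le> l' * p" using mu_le[of i] by (intro mult_le_mono1) simp
      hence "\<mu> i * p + i < l' * p" using i by simp
      hence "\<not> new_row (obs_row C A p) n (\<mu> i * p + i)" using K_mu[of i] by (simp add: K_def)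
      from data_relation[OF S p u y this] show ?thesis unfolding dm .
    qed
  qed
  have "\<forall>i. \<exists>\<alpha> \<beta>. i < p \<longrightarrow> (\<forall>t. t + \<mu> i < T \<longrightarrow>
      y $$ (i, t + \<mu> i) = (\<Sum>q<\<mu> i * p + i. \<alpha> q * y $$ (q mod p, t + q div p))
        + (\<Sum>s\<le>\<mu> i. \<Sum>j<m. \<beta> s j * u $$ (j, t + s)))"
    using rel by blast
  from choice[OF this] obtain \<alpha> where "\<forall>i. \<exists>\<beta>. i < p \<longrightarrow> (\<forall>t. t + \<mu> i < T \<longrightarrow>
      y $$ (i, t + \<mu> i) = (\<Sum>q<\<mu> i * p + i. \<alpha> i q * y $$ (q mod p, t + q div p))
        + (\<Sum>s\<le>\<mu> i. \<Sum>j<m. \<beta> s j * u $$ (j, t + s)))" by blast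
  from choice[OF this] obtain \<beta> where "\<And>i t. i < p \<Longrightarrow> t + \<mu> i < T \<Longrightarrow>
      y $$ (i, t + \<mu> i) = (\<Sum>q<\<mu> i * p + i. \<alpha> i q * y $$ (q mod p, t + q div p))
        + (\<Sum>s\<le>\<mu> i. \<Sum>j<m. \<beta> i s j * u $$ (j, t + s))" by blast
  from realization[OF u y this] have "expl_systems u y (\<Sum>i<p. \<mu> i) \<noteq> {}" .
  hence "n_min u y \<le> (\<Sum>i<p. \<mu> i)" unfolding n_min_def by (rule Least_le)
  also have "\<dots> = card (Sigma {..<p} (\<lambda>i. {..<\<mu> i}))" by simp
  also have "\<dots> \<le> card K"
  \<comment> \<open>A state \<open>(i, k)\<close> is sent to row \<open>i\<close> of block
    \<open>k\<close>; since \<open>i < p\<close>, division with remainder recovers the pair.\<close>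
  proof (rule card_inj_on_le[OF _ _ finK])
    show "inj_on (\<lambda>(i, k). k * p + i) (Sigma {..<p} (\<lambda>i. {..<\<mu> i}))"
    proof (rule inj_onI, clarsimp)
      fix i k j h assume "k * p + i = h * p + j" "i < p" "j < p"
      hence "(k * p + i) div p = (h * p + j) div p" "(k * p + i) mod p = (h * p + j) mod p" by simp_all
      with \<open>i < p\<close> \<open>j < p\<close> show "i = j \<and> k = h" by simp
    qed
    show "(\<lambda>(i, k). k * p + i) ` Sigma {..<p} (\<lambda>i. {..<\<mu> i}) \<subseteq> K" using K_less by auto
  qed
  finally have "n_min u y + (l - l') \<le> n" using cardK by linarith
  thus ?thesis using l'l unfolding l'_def by linarith
qed

end
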